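(* Let $P^I = P^I_1\times\dots\times P^I_k$ be a feasible decomposable mixed-binary set, where for each $i\in\{1,\dots,k\}$ $$P^I_i = P_i\cap(\{0,1\}^{n_i}\times\mathbb{R}^{d_i}),\qquad P_i=\{(x^i,y^i)\in[0,1]^{n_i}\times\mathbb{R}^{d_i} : A^i x^i+B^i y^i\le b^i\}.$$ Let $s_i$ be such that each constraint in $P^I_i$ has at most $s_i$ binary variables, and define $c_i:=\min\{s_i\cdot(d_i+1),\,n_i\}$. Let $\delta\in(0,1)$. Then with probability at least $1-\delta$, the algorithm mbWalkSAT with parameter $\ell=1$ returns a feasible solution within $$\ln(k/\delta)\,\sum_{i=1}^k n_i\,2^{n_i\log c_i}$$ iterations. In particular, this bound is at most $\bar n\,k\,2^{\bar n\log\bar n}\cdot\ln(k/\delta)$, where $\bar n=\max_i n_i$.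
   Context: Here $\log$ is base 2, and $\mathrm{supp}(v)$ is the set of coordinates where the vector $v$ is nonzero. The case $k=1$ is allowed, so a general mixed-binary set is also covered. A decomposable set is treated as a mixed-binary set $P^I=P\cap(\{0,1\}^n\times\mathbb{R}^d)$ with $P=\{(x,y)\in[0,1]^n\times\mathbb{R}^d: Ax+By\le b\}$ (with $m$ rows), where $P=P_1\times\dots\times P_k$ is the LP relaxation, $n=\sum_i n_i$, $d=\sum_i d_i$, and the system $Ax+By\le b$ is the collection of the systems $A^ix^i+B^iy^i\le b^i$ of all blocks. $\mathrm{proj}_{bin}P$ denotes the projection of $P$ onto the binary variables $x$. Projected certificate: for a point $(\bar x,\bar y)\in\{0,1\}^n\times\mathbb{R}^d$ with $\bar x\notin\mathrm{proj}_{bin}P$, a projected certificate for $\bar x$ is an inequality $\lambda Ax+\lambda By\le\lambda b$ with $\lambda\in\mathbb{R}^m_+$ such that (i) $\bar x$ does not satisfy this inequality and (ii) $\lambda B=0$ (so it has the form $ax\le\beta$ with $a=\lambda A$, $\beta=\lambda b$). A minimal projected certificate is one where the support of $\lambda$ is minimal, i.e. the certificate uses a minimal set of the original inequalities. Randomization step RandWalkSAT$_\ell(\bar x)$, for $\bar x\notin\mathrm{proj}_{bin}P$: let $ax\le\beta$ be a minimal projected certificate for $\bar x$; sample $\ell$ indices from $\mathrm{supp}(a)$ uniformly and independently, and let $\mathbf I$ be the set of indices obtained; for all $i\in\mathbf I$, set $\bar x_i\leftarrow 1-\bar x_i$. Algorithm mbWalkSAT with integer parameter $\ell\ge1$: start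 with any mixed-binary point $(\bar x,\bar y)\in\{0,1\}^n\times\mathbb{R}^d$; then loop: if $\bar x\notin\mathrm{proj}_{bin}P$, apply RandWalkSAT$_\ell$ to $\bar x$; otherwise find $\bar y\in\mathbb{R}^d$ such that $(\bar x,\bar y)\in P$ and return $(\bar x,\bar y)$.
   Formalization: The stated bound can fail when ln(k/δ)<1 (x₁≥1, x₂≥1, start (0,0), δ>1/e). It is proved, rounded down, when ln(k/δ)≥1; for every δ∈(0,1) the proved bound is Σ n_i⌈ln(k/δ)·2^{n_i log c_i}⌉. If c_i=0, log c_i is read as 0. *)

theory Defs
  imports "HOL-Probability.Probability"
begin

text \<open>
  Vectors are extensional functions on finite index sets, so that the dimensions of the blocks of
  a decomposable set may vary with the block: for example \<open>I \<rightarrow>\<^sub>E {0,1}\<close> is the set of binary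
  vectors with coordinates in \<open>I\<close>.
\<close>

record ('r, 'v, 'c) mb_system =
  constrs :: "'r set"
  bins :: "'v set"
  conts :: "'c set"
  Acoef :: "'r \<Rightarrow> 'v \<Rightarrow> real"
  Bcoef :: "'r \<Rightarrow> 'c \<Rightarrow> real"
  rhs :: "'r \<Rightarrow> real"

definition finite_system :: "('r, 'v, 'c) mb_system \<Rightarrow> bool" where
  "finite_system S \<longleftrightarrow> finite (constrs S) \<and> finite (bins S) \<and> finite (conts S)"

definition lp_relax :: "('r, 'v, 'c) mb_system \<Rightarrow> (('v \<Rightarrow> real) \<times> ('c \<Rightarrow> real)) set" where
  "lp_relax S = {(x, y). x \<in> bins S \<rightarrow>\<^sub>E {0..1} \<and> y \<in> conts S \<rightarrow>\<^sub>E UNIV \<and>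
     (\<forall>r\<in>constrs S.
        (\<Sum>j\<in>bins S. Acoef S r j * x j) + (\<Sum>j\<in>conts S. Bcoef S r j * y j) \<le> rhs S r)}"

definition mb_points :: "('r, 'v, 'c) mb_system \<Rightarrow> (('v \<Rightarrow> real) \<times> ('c \<Rightarrow> real)) set" where
  "mb_points S = (bins S \<rightarrow>\<^sub>E {0, 1}) \<times> (conts S \<rightarrow>\<^sub>E UNIV)"

definition mb_set :: "('r, 'v, 'c) mb_system \<Rightarrow> (('v \<Rightarrow> real) \<times> ('c \<Rightarrow> real)) set" where
  "mb_set S = lp_relax S \<inter> mb_points S"

definition proj_bin :: "('r, 'v, 'c) mb_system \<Rightarrow> ('v \<Rightarrow> real) set" where
  "proj_bin S = fst ` lp_relax S"

text \<open>
  The system of a decomposable set with blocks \<open>Q 1, \<dots>, Q k\<close>. Row or coordinate \<open>j\<close> of block \<open>i\<close>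
  becomes the row or coordinate \<open>(i, j)\<close>, and the coefficient matrices are block diagonal.
\<close>

definition mb_product ::
    "nat \<Rightarrow> (nat \<Rightarrow> ('r, 'v, 'c) mb_system) \<Rightarrow> (nat \<times> 'r, nat \<times> 'v, nat \<times> 'c) mb_system" where
  "mb_product k Q =
    \<lparr> constrs = (SIGMA i:{1..k}. constrs (Q i)),
      bins = (SIGMA i:{1..k}. bins (Q i)),
      conts = (SIGMA i:{1..k}. conts (Q i)),
      Acoef = (\<lambda>(i, r) (i', j). if i = i' then Acoef (Q i) r j else 0),
      Bcoef = (\<lambda>(i, r) (i', j). if i = i' then Bcoef (Q i) r j else 0),
      rhs = (\<lambda>(i, r). rhs (Q i) r) \<rparr>"

lemma sum_block:
  fixes g :: "'v \<Rightarrow> real" and x :: "nat \<times> 'v \<Rightarrow> real"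
  assumes "\<And>i. i \<in> {1..k} \<Longrightarrow> finite (J i)" and "i \<in> {1..k}"
  shows "(\<Sum>p\<in>(SIGMA i:{1..k}. J i). (case p of (i', j) \<Rightarrow> if i = i' then g j else 0) * x p) =
         (\<Sum>j\<in>J i. g j * x (i, j))"
proof -
  have "(\<Sum>p\<in>(SIGMA i:{1..k}. J i). (case p of (i', j) \<Rightarrow> if i = i' then g j else 0) * x p) =
        (\<Sum>i'\<in>{1..k}. \<Sum>j\<in>J i'. (if i = i' then g j else 0) * x (i', j))"
    using assms(1) by (subst sum.Sigma) (auto intro!: sum.cong)
  also have "\<dots> = (\<Sum>i'\<in>{1..k}. if i' = i then (\<Sum>j\<in>J i'. g j * x (i', j)) else 0)"
    by (intro sum.cong) auto
  also have "\<dots> = (\<Sum>j\<in>J i. g j * x (i, j))"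
    using assms(2) by simp
  finally show ?thesis .
qed

text \<open>\<open>mb_product k Q\<close> does describe the product of the blocks.\<close>

lemma lp_relax_mb_product:
  assumes fin: "\<And>i. i \<in> {1..k} \<Longrightarrow> finite_system (Q i)"
    and x: "x \<in> bins (mb_product k Q) \<rightarrow>\<^sub>E UNIV"
    and y: "y \<in> conts (mb_product k Q) \<rightarrow>\<^sub>E UNIV"
  shows "(x, y) \<in> lp_relax (mb_product k Q) \<longleftrightarrow>
    (\<forall>i\<in>{1..k}. (\<lambda>j\<in>bins (Q i). x (i, j), \<lambda>j\<in>conts (Q i). y (i, j)) \<in> lp_relax (Q i))"
proof -
  have A: "(\<Sum>p\<in>bins (mb_product k Q). Acoef (mb_product k Q) (i, r) p * x p) =
           (\<Sum>j\<in>bins (Q i). Acoef (Q i) r j * x (i, j))" if "i \<in> {1..k}" for i r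
    using sum_block[of k "\<lambda>i. bins (Q i)" i "Acoef (Q i) r" x] fin that
    by (simp add: mb_product_def finite_system_def)
  have B: "(\<Sum>p\<in>conts (mb_product k Q). Bcoef (mb_product k Q) (i, r) p * y p) =
           (\<Sum>j\<in>conts (Q i). Bcoef (Q i) r j * y (i, j))" if "i \<in> {1..k}" for i r
    using sum_block[of k "\<lambda>i. conts (Q i)" i "Bcoef (Q i) r" y] fin that
    by (simp add: mb_product_def finite_system_def)
  have 1: "(\<forall>p\<in>constrs (mb_product k Q).
        (\<Sum>j\<in>bins (mb_product k Q). Acoef (mb_product k Q) p j * x j) +
        (\<Sum>j\<in>conts (mb_product k Q). Bcoef (mb_product k Q) p j * y j) \<le> rhs (mb_product k Q) p)
     \<longleftrightarrow> (\<forall>i\<in>{1..k}. \<forall>r\<in>constrs (Q i).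
        (\<Sum>j\<in>bins (Q i). Acoef (Q i) r j * x (i, j)) +
        (\<Sum>j\<in>conts (Q i). Bcoef (Q i) r j * y (i, j)) \<le> rhs (Q i) r)"
  proof -
    have "(\<forall>p\<in>constrs (mb_product k Q). F p \<le> rhs (mb_product k Q) p) \<longleftrightarrow>
          (\<forall>i\<in>{1..k}. \<forall>r\<in>constrs (Q i). F (i, r) \<le> rhs (Q i) r)" for F
      by (auto simp: mb_product_def)
    then show ?thesis using A B by simp
  qed
  have 2: "x \<in> bins (mb_product k Q) \<rightarrow>\<^sub>E {0..1} \<longleftrightarrow>
      (\<forall>i\<in>{1..k}. (\<lambda>j\<in>bins (Q i). x (i, j)) \<in> bins (Q i) \<rightarrow>\<^sub>E {0..1})"
    using x by (auto simp: mb_product_def PiE_iff)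
  have 3: "(\<lambda>j\<in>conts (Q i). y (i, j)) \<in> conts (Q i) \<rightarrow>\<^sub>E UNIV" for i
    by auto
  have 4: "(\<lambda>j\<in>bins (Q i). x (i, j), \<lambda>j\<in>conts (Q i). y (i, j)) \<in> lp_relax (Q i) \<longleftrightarrow>
      (\<lambda>j\<in>bins (Q i). x (i, j)) \<in> bins (Q i) \<rightarrow>\<^sub>E {0..1} \<and>
      (\<forall>r\<in>constrs (Q i). (\<Sum>j\<in>bins (Q i). Acoef (Q i) r j * x (i, j)) +
        (\<Sum>j\<in>conts (Q i). Bcoef (Q i) r j * y (i, j)) \<le> rhs (Q i) r)" for i
    unfolding lp_relax_def mem_Collect_eq case_prod_conv using 3[of i] by simp
  show ?thesis
    unfolding 4 unfolding lp_relax_def mem_Collect_eq case_prod_conv 1 2 using y by blast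
qed

lemma mb_set_mb_product:
  assumes fin: "\<And>i. i \<in> {1..k} \<Longrightarrow> finite_system (Q i)"
    and x: "x \<in> bins (mb_product k Q) \<rightarrow>\<^sub>E UNIV"
    and y: "y \<in> conts (mb_product k Q) \<rightarrow>\<^sub>E UNIV"
  shows "(x, y) \<in> mb_set (mb_product k Q) \<longleftrightarrow>
    (\<forall>i\<in>{1..k}. (\<lambda>j\<in>bins (Q i). x (i, j), \<lambda>j\<in>conts (Q i). y (i, j)) \<in> mb_set (Q i))"
proof -
  have "(x, y) \<in> mb_points (mb_product k Q) \<longleftrightarrow>
    (\<forall>i\<in>{1..k}. (\<lambda>j\<in>bins (Q i). x (i, j), \<lambda>j\<in>conts (Q i). y (i, j)) \<in> mb_points (Q i))"
    using x y by (simp add: mb_points_def mb_product_def PiE_iff)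
  moreover have "(x, y) \<in> lp_relax (mb_product k Q) \<longleftrightarrow>
    (\<forall>i\<in>{1..k}. (\<lambda>j\<in>bins (Q i). x (i, j), \<lambda>j\<in>conts (Q i). y (i, j)) \<in> lp_relax (Q i))"
    using assms by (rule lp_relax_mb_product)
  ultimately show ?thesis
    unfolding mb_set_def Int_iff by blast
qed

definition supp :: "'i set \<Rightarrow> ('i \<Rightarrow> real) \<Rightarrow> 'i set" where
  "supp I v = {i \<in> I. v i \<noteq> 0}"

definition cert_a :: "('r, 'v, 'c) mb_system \<Rightarrow> ('r \<Rightarrow> real) \<Rightarrow> 'v \<Rightarrow> real" where
  "cert_a S l = (\<lambda>j\<in>bins S. \<Sum>r\<in>constrs S. l r * Acoef S r j)"

definition cert_beta :: "('r, 'v, 'c) mb_system \<Rightarrow> ('r \<Rightarrow> real) \<Rightarrow> real" where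
  "cert_beta S l = (\<Sum>r\<in>constrs S. l r * rhs S r)"

definition projected_certificate ::
    "('r, 'v, 'c) mb_system \<Rightarrow> ('v \<Rightarrow> real) \<Rightarrow> ('r \<Rightarrow> real) \<Rightarrow> bool" where
  "projected_certificate S x l \<longleftrightarrow>
     l \<in> constrs S \<rightarrow>\<^sub>E {0..} \<and>
     \<not> (\<Sum>j\<in>bins S. cert_a S l j * x j) \<le> cert_beta S l \<and>
     (\<forall>j\<in>conts S. (\<Sum>r\<in>constrs S. l r * Bcoef S r j) = 0)"

definition minimal_certificate ::
    "('r, 'v, 'c) mb_system \<Rightarrow> ('v \<Rightarrow> real) \<Rightarrow> ('r \<Rightarrow> real) \<Rightarrow> bool" where
  "minimal_certificate S x l \<longleftrightarrow>
     projected_certificate S x l \<and>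
     \<not> (\<exists>l'. projected_certificate S x l' \<and> supp (constrs S) l' \<subset> supp (constrs S) l)"

definition flip :: "'v set \<Rightarrow> ('v \<Rightarrow> real) \<Rightarrow> 'v \<Rightarrow> real" where
  "flip I x = (\<lambda>i. if i \<in> I then 1 - x i else x i)"

text \<open>The set of sampled indices is flipped, so an index that is drawn twice is flipped once.\<close>

definition RandWalkSAT ::
    "nat \<Rightarrow> ('r, 'v, 'c) mb_system \<Rightarrow> ('r \<Rightarrow> real) \<Rightarrow> ('v \<Rightarrow> real) \<Rightarrow> ('v \<Rightarrow> real) pmf" where
  "RandWalkSAT ell S l x =
     map_pmf (\<lambda>js. flip (set js) x) (replicate_pmf ell (pmf_of_set (supp (bins S) (cert_a S l))))"

text \<open>
  The algorithm does not fix which minimal certificate and which continuous part \<open>y\<close> are taken.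
  These choices are parameters: \<open>cert h x\<close> is the multiplier vector used at \<open>x\<close> after the binary
  points \<open>h\<close> were visited (latest first), so it may depend on the history of the run, and \<open>lift x\<close>
  is the continuous part returned with \<open>x\<close>.
\<close>

definition valid_cert_rule ::
    "('r, 'v, 'c) mb_system \<Rightarrow> (('v \<Rightarrow> real) list \<Rightarrow> ('v \<Rightarrow> real) \<Rightarrow> ('r \<Rightarrow> real)) \<Rightarrow> bool" where
  "valid_cert_rule S cert \<longleftrightarrow>
     (\<forall>h x. x \<in> bins S \<rightarrow>\<^sub>E {0, 1} \<and> x \<notin> proj_bin S \<longrightarrow> minimal_certificate S x (cert h x))"

definition valid_lift_rule ::
    "('r, 'v, 'c) mb_system \<Rightarrow> (('v \<Rightarrow> real) \<Rightarrow> ('c \<Rightarrow> real)) \<Rightarrow> bool" where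
  "valid_lift_rule S lift \<longleftrightarrow>
     (\<forall>x. x \<in> bins S \<rightarrow>\<^sub>E {0, 1} \<and> x \<in> proj_bin S \<longrightarrow> (x, lift x) \<in> lp_relax S)"

text \<open>
  The run of mbWalkSAT cut off after \<open>t\<close> iterations, where an iteration is one application of
  the randomization step. The outcome \<open>Some (x, y)\<close> means that \<open>(x, y)\<close> is returned within \<open>t\<close>
  iterations, \<open>None\<close> that the algorithm has not returned yet.
\<close>

primrec mbWalkSAT_from ::
    "nat \<Rightarrow> ('r, 'v, 'c) mb_system \<Rightarrow> (('v \<Rightarrow> real) list \<Rightarrow> ('v \<Rightarrow> real) \<Rightarrow> ('r \<Rightarrow> real)) \<Rightarrow>
     (('v \<Rightarrow> real) \<Rightarrow> ('c \<Rightarrow> real)) \<Rightarrow> nat \<Rightarrow> ('v \<Rightarrow> real) list \<Rightarrow> ('v \<Rightarrow> real) \<Rightarrow>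
     (('v \<Rightarrow> real) \<times> ('c \<Rightarrow> real)) option pmf" where
  "mbWalkSAT_from ell S cert lift 0 h x =
     (if x \<in> proj_bin S then return_pmf (Some (x, lift x)) else return_pmf None)"
| "mbWalkSAT_from ell S cert lift (Suc t) h x =
     (if x \<in> proj_bin S then return_pmf (Some (x, lift x))
      else bind_pmf (RandWalkSAT ell S (cert h x) x)
             (\<lambda>x'. mbWalkSAT_from ell S cert lift t (x # h) x'))"

definition mbWalkSAT ::
    "nat \<Rightarrow> ('r, 'v, 'c) mb_system \<Rightarrow> (('v \<Rightarrow> real) list \<Rightarrow> ('v \<Rightarrow> real) \<Rightarrow> ('r \<Rightarrow> real)) \<Rightarrow>
     (('v \<Rightarrow> real) \<Rightarrow> ('c \<Rightarrow> real)) \<Rightarrow> ('v \<Rightarrow> real) \<times> ('c \<Rightarrow> real) \<Rightarrow> nat \<Rightarrow>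
     (('v \<Rightarrow> real) \<times> ('c \<Rightarrow> real)) option pmf" where
  "mbWalkSAT ell S cert lift start t = mbWalkSAT_from ell S cert lift t [] (fst start)"

end

theory Submission
  imports Defs
begin

text \<open>
  Fix a feasible binary point \<open>z\<close>. A minimal certificate at \<open>x\<close> lives in one block \<open>i\<close>, and a
  basic-solution argument bounds its support by \<open>d\<^sub>i + 1\<close> rows, hence that of \<open>a\<close> by \<open>c\<^sub>i\<close>. As \<open>z\<close>
  satisfies the certificate and \<open>x\<close> does not, they differ on the support of \<open>a\<close>, so a random flip
  moves block \<open>i\<close> towards \<open>z\<close> with probability at least \<open>1 / c\<^sub>i\<close>, and with certainty if \<open>x\<close> and \<open>z\<close>
  differ in the whole block. Thus \<open>n\<^sub>i\<close> flips in block \<open>i\<close> repair it with probability at least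
  \<open>c\<^sub>i\<close> to the power \<open>- (n\<^sub>i - 1)\<close>. The failure probability of the run is at most the sum over
  the blocks of the failure probabilities after \<open>r\<^sub>i\<close> flips, provided that there are at least
  \<open>\<Sum>\<^sub>i r\<^sub>i\<close> iterations; this is proved by induction on the number of iterations, with no reference
  to the rule which chooses the blocks.
\<close>

section \<open>Linear algebra: underdetermined homogeneous systems\<close>

text \<open>Gaussian elimination. An equation \<open>j\<close> with a nonzero coefficient at
  \<open>r0\<close> is solved for the unknown of \<open>r0\<close>; substituting it into the others
  removes one equation and one unknown. An equation with only zero coefficients is dropped.\<close>

lemma homogeneous_system_nontrivial_solution:
  fixes M :: "'a \<Rightarrow> 'b \<Rightarrow> real"
  assumes "finite J" "finite R" "card J < card R"
  shows "\<exists>\<mu>. (\<exists>r\<in>R. \<mu> r \<noteq> 0) \<and> (\<forall>j\<in>J. (\<Sum>r\<in>R. \<mu> r * M r j) = 0)"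
  using assms
proof (induction J arbitrary: R M rule: finite_induct)
  case empty
  then have "R \<noteq> {}" by auto
  then show ?case by (intro exI[of _ "\<lambda>_. 1"]) auto
next
  case (insert j J)
  show ?case
  proof (cases "\<forall>r\<in>R. M r j = 0")
    case True
    obtain \<mu> where "\<exists>r\<in>R. \<mu> r \<noteq> 0" "\<forall>j\<in>J. (\<Sum>r\<in>R. \<mu> r * M r j) = 0"
      using insert.IH[of R M] insert.prems insert.hyps by auto
    with True show ?thesis by (intro exI[of _ \<mu>]) auto
  next
    case False
    then obtain r0 where r0: "r0 \<in> R" "M r0 j \<noteq> 0" by auto
    define R' where "R' = R - {r0}"
    have fin: "finite R'" and R: "R = insert r0 R'" "r0 \<notin> R'"
      using insert.prems r0 by (auto simp: R'_def)
    have "card J < card R'"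
      using insert.prems insert.hyps r0 by (simp add: R'_def)
    then obtain \<mu> where \<mu>: "\<exists>r\<in>R'. \<mu> r \<noteq> 0"
      "\<forall>j'\<in>J. (\<Sum>r\<in>R'. \<mu> r * (M r j' - M r j / M r0 j * M r0 j')) = 0"
      using insert.IH[of R' "\<lambda>r j'. M r j' - M r j / M r0 j * M r0 j'"] fin by auto
    \<comment> \<open>This is the value that equation \<open>j\<close> forces on the eliminated
      unknown.\<close>
    define t where "t = - (\<Sum>r\<in>R'. \<mu> r * (M r j / M r0 j))"
    define \<nu> where "\<nu> = \<mu>(r0 := t)"
    have \<nu>: "(\<Sum>r\<in>R. \<nu> r * M r j') = t * M r0 j' + (\<Sum>r\<in>R'. \<mu> r * M r j')" for j'
    proof -
      have "(\<Sum>r\<in>R'. \<nu> r * M r j') = (\<Sum>r\<in>R'. \<mu> r * M r j')"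
        using R by (intro sum.cong) (auto simp: \<nu>_def)
      then show ?thesis using R fin by (simp add: \<nu>_def)
    qed
    have t: "t * M r0 j' = - (\<Sum>r\<in>R'. \<mu> r * (M r j / M r0 j * M r0 j'))" for j'
      by (simp add: t_def sum_distrib_right mult.assoc)
    have "(\<Sum>r\<in>R. \<nu> r * M r j) = 0"
      unfolding \<nu> t using r0 by simp
    moreover have "(\<Sum>r\<in>R. \<nu> r * M r j') = 0" if "j' \<in> J" for j'
    proof -
      have "(\<Sum>r\<in>R'. \<mu> r * M r j') - (\<Sum>r\<in>R'. \<mu> r * (M r j / M r0 j * M r0 j')) = 0"
        using \<mu>(2) that by (simp add: sum_subtractf[symmetric] right_diff_distrib)
      then show ?thesis unfolding \<nu> t by simp
    qed
    moreover have "\<exists>r\<in>R. \<nu> r \<noteq> 0"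
      using \<mu>(1) R by (auto simp: \<nu>_def)
    ultimately show ?thesis by (intro exI[of _ \<nu>]) auto
  qed
qed

section \<open>Projected certificates and the support of minimal ones\<close>

text \<open>The continuous terms are left out because multipliers with \<open>\<lambda>B = 0\<close>
  cancel them. Cutting off \<open>x\<close> then becomes positivity of a linear function of
  \<open>l\<close>.\<close>

definition violation :: "('r, 'v, 'c) mb_system \<Rightarrow> ('v \<Rightarrow> real) \<Rightarrow> 'r \<Rightarrow> real" where
  "violation S x r = (\<Sum>j\<in>bins S. Acoef S r j * x j) - rhs S r"

lemma cert_a_minus_cert_beta:
  "(\<Sum>j\<in>bins S. cert_a S l j * x j) - cert_beta S l = (\<Sum>r\<in>constrs S. l r * violation S x r)"
proof -
  have "(\<Sum>j\<in>bins S. cert_a S l j * x j) =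
      (\<Sum>j\<in>bins S. \<Sum>r\<in>constrs S. l r * (Acoef S r j * x j))"
    by (intro sum.cong) (auto simp: cert_a_def sum_distrib_right mult.assoc)
  also have "\<dots> = (\<Sum>r\<in>constrs S. l r * (\<Sum>j\<in>bins S. Acoef S r j * x j))"
    by (subst sum.swap) (simp add: sum_distrib_left)
  finally show ?thesis
    by (simp add: cert_beta_def violation_def right_diff_distrib sum_subtractf)
qed

lemma projected_certificate_iff:
  "projected_certificate S x l \<longleftrightarrow>
     l \<in> constrs S \<rightarrow>\<^sub>E {0..} \<and> 0 < (\<Sum>r\<in>constrs S. l r * violation S x r) \<and>
     (\<forall>j\<in>conts S. (\<Sum>r\<in>constrs S. l r * Bcoef S r j) = 0)"
  unfolding projected_certificate_def cert_a_minus_cert_beta[symmetric] by auto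

text \<open>If \<open>x\<close> and \<open>z\<close> agreed on the support of \<open>a\<close>, the
  certificate would cut off \<open>z\<close> too. But some \<open>y\<close> completes
  \<open>z\<close> to a point of the relaxation, and combining its rows with the multipliers cancels
  \<open>y\<close> and gives \<open>az \<le> \<beta>\<close>.\<close>

lemma certificate_separates:
  assumes l: "projected_certificate S x l" and z: "z \<in> proj_bin S"
  shows "\<exists>p\<in>supp (bins S) (cert_a S l). x p \<noteq> z p"
proof (rule ccontr)
  assume contra: "\<not> ?thesis"
  obtain y where y: "(z, y) \<in> lp_relax S"
    using z by (auto simp: proj_bin_def)
  have "(\<Sum>j\<in>bins S. cert_a S l j * x j) = (\<Sum>j\<in>bins S. cert_a S l j * z j)"
    using contra by (intro sum.cong) (auto simp: supp_def)
  then have "0 < (\<Sum>r\<in>constrs S. l r * violation S z r)"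
    using l unfolding projected_certificate_iff cert_a_minus_cert_beta[symmetric] by simp
  moreover have "(\<Sum>r\<in>constrs S. l r * violation S z r) \<le>
      (\<Sum>r\<in>constrs S. l r * - (\<Sum>j\<in>conts S. Bcoef S r j * y j))"
  proof (intro sum_mono mult_left_mono)
    fix r assume "r \<in> constrs S"
    then show "violation S z r \<le> - (\<Sum>j\<in>conts S. Bcoef S r j * y j)" "0 \<le> l r"
      using y l by (auto simp: lp_relax_def violation_def projected_certificate_def)
  qed
  moreover have "(\<Sum>r\<in>constrs S. l r * (\<Sum>j\<in>conts S. Bcoef S r j * y j)) =
      (\<Sum>j\<in>conts S. (\<Sum>r\<in>constrs S. l r * Bcoef S r j) * y j)"
    unfolding sum_distrib_left sum_distrib_right by (subst sum.swap) (simp add: mult.assoc)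
  moreover have "\<dots> = 0"
    using l by (simp add: projected_certificate_def)
  ultimately show False by (simp add: sum_negf)
qed

text \<open>With more rows in the support, some nonzero direction \<open>\<mu>\<close> on them
  preserves the columns in \<open>J\<close> and the total violation. Moving \<open>l\<close> along
  it until a multiplier vanishes contradicts minimality. Having \<open>J\<close> as a parameter
  allows counting only the columns of one block in a product.\<close>

lemma minimal_certificate_card_supp:
  assumes fin: "finite_system S" and l: "minimal_certificate S x l" and J: "J \<subseteq> conts S"
    and zero: "\<And>r j. r \<in> supp (constrs S) l \<Longrightarrow> j \<in> conts S - J \<Longrightarrow> Bcoef S r j = 0"
  shows "card (supp (constrs S) l) \<le> card J + 1"
proof (rule ccontr)
  define R where "R = supp (constrs S) l"
  assume "\<not> card (supp (constrs S) l) \<le> card J + 1"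
  then have card: "card J + 1 < card R" by (simp add: R_def)
  have finR: "finite R" and finC: "finite (constrs S)" and finJ: "finite J"
    using fin J finite_subset by (auto simp: R_def supp_def finite_system_def)
  have RC: "R \<subseteq> constrs S" by (auto simp: R_def supp_def)
  have l': "l \<in> constrs S \<rightarrow>\<^sub>E {0..}" "0 < (\<Sum>r\<in>constrs S. l r * violation S x r)"
    "\<And>j. j \<in> conts S \<Longrightarrow> (\<Sum>r\<in>constrs S. l r * Bcoef S r j) = 0"
    using l by (auto simp: minimal_certificate_def projected_certificate_iff)
  have lpos: "0 < l r" if "r \<in> R" for r
    using that l'(1) by (force simp: R_def supp_def PiE_iff)
  \<comment> \<open>\<open>None\<close> indexes the equation that preserves the violation,
    \<open>Some j\<close> the one for column \<open>j\<close>.\<close>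
  define M where "M = (\<lambda>r. case_option (violation S x r) (Bcoef S r))"
  have "card (insert None (Some ` J)) < card R"
    using card finJ by (simp add: card_image)
  then obtain \<mu>0 where \<mu>0: "\<exists>r\<in>R. \<mu>0 r \<noteq> 0"
    "\<forall>j\<in>insert None (Some ` J). (\<Sum>r\<in>R. \<mu>0 r * M r j) = 0"
    using homogeneous_system_nontrivial_solution[of "insert None (Some ` J)" R M] finJ finR by auto
  \<comment> \<open>A change of sign, if necessary, provides a positive entry, so subtracting
    multiples of \<open>\<mu>\<close> eventually makes a multiplier vanish.\<close>
  obtain \<mu> where \<mu>: "\<exists>r\<in>R. 0 < \<mu> r" "(\<Sum>r\<in>R. \<mu> r * violation S x r) = 0"
    "\<And>j. j \<in> J \<Longrightarrow> (\<Sum>r\<in>R. \<mu> r * Bcoef S r j) = 0"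
  proof (cases "\<exists>r\<in>R. 0 < \<mu>0 r")
    case True
    with \<mu>0 show ?thesis by (intro that[of \<mu>0]) (auto simp: M_def)
  next
    case False
    with \<mu>0 have "\<exists>r\<in>R. 0 < - \<mu>0 r" by force
    with \<mu>0 show ?thesis by (intro that[of "\<lambda>r. - \<mu>0 r"]) (auto simp: M_def sum_negf)
  qed
  \<comment> \<open>Ratio test: the minimal ratio at \<open>r0\<close> is the largest step
    \<open>t\<close> that keeps all multipliers nonnegative, and it makes the one of
    \<open>r0\<close> vanish.\<close>
  define R1 where "R1 = {r\<in>R. 0 < \<mu> r}"
  have "finite R1" "R1 \<noteq> {}" using finR \<mu>(1) by (auto simp: R1_def)
  then obtain r0 where r0: "r0 \<in> R1" "\<And>r. r \<in> R1 \<Longrightarrow> l r0 / \<mu> r0 \<le> l r / \<mu> r"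
    using ex_is_arg_min_if_finite[of R1 "\<lambda>r. l r / \<mu> r"] by (force simp: is_arg_min_linorder)
  define t where "t = l r0 / \<mu> r0"
  have t0: "0 \<le> t" using r0(1) lpos by (force simp: t_def R1_def)
  define l2 where "l2 = (\<lambda>r\<in>constrs S. if r \<in> R then l r - t * \<mu> r else 0)"
  have sum: "(\<Sum>r\<in>constrs S. l2 r * f r) =
      (\<Sum>r\<in>constrs S. l r * f r) - t * (\<Sum>r\<in>R. \<mu> r * f r)" for f
  proof -
    have "(\<Sum>r\<in>constrs S. l2 r * f r) = (\<Sum>r\<in>R. l2 r * f r)"
      using RC finC by (intro sum.mono_neutral_right) (auto simp: l2_def)
    also have "\<dots> = (\<Sum>r\<in>R. l r * f r) - t * (\<Sum>r\<in>R. \<mu> r * f r)"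
      unfolding sum_distrib_left sum_subtractf[symmetric]
      using RC by (intro sum.cong) (auto simp: l2_def algebra_simps)
    also have "(\<Sum>r\<in>R. l r * f r) = (\<Sum>r\<in>constrs S. l r * f r)"
      using RC finC by (intro sum.mono_neutral_left) (auto simp: R_def supp_def)
    finally show ?thesis .
  qed
  have nonneg: "0 \<le> l r - t * \<mu> r" if "r \<in> R" for r
  proof (cases "0 < \<mu> r")
    case True
    then show ?thesis using r0(2)[of r] that by (simp add: t_def R1_def le_divide_eq)
  next
    case False
    then have "t * \<mu> r \<le> 0" using t0 by (simp add: mult_le_0_iff)
    then show ?thesis using lpos[OF that] by simp
  qed
  have "(\<Sum>r\<in>R. \<mu> r * Bcoef S r j) = 0" if "j \<in> conts S" for j
    using \<mu>(3) zero that by (cases "j \<in> J") (auto simp: R_def)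
  then have "projected_certificate S x l2"
    unfolding projected_certificate_iff sum using l'(2,3) \<mu>(2) nonneg by (auto simp: l2_def)
  moreover have "supp (constrs S) l2 \<subset> supp (constrs S) l"
  proof
    show "supp (constrs S) l2 \<subseteq> supp (constrs S) l"
      by (auto simp: supp_def l2_def R_def)
    have "r0 \<in> R" "l2 r0 = 0" using r0(1) RC by (auto simp: l2_def R1_def t_def)
    then show "supp (constrs S) l2 \<noteq> supp (constrs S) l"
      by (auto simp: R_def supp_def)
  qed
  ultimately show False using l unfolding minimal_certificate_def by blast
qed

section \<open>Certificates of a product of blocks\<close>

lemma finite_system_mb_product:
  "(\<And>i. i \<in> {1..k} \<Longrightarrow> finite_system (Q i)) \<Longrightarrow> finite_system (mb_product k Q)"
  by (auto simp: finite_system_def mb_product_def intro!: finite_SigmaI)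

text \<open>Restricting the multipliers to one block keeps \<open>\<lambda>B = 0\<close>, and one of the restrictions still
  cuts off \<open>x\<close>.\<close>

lemma minimal_certificate_in_block:
  assumes fin: "\<And>i. i \<in> {1..k} \<Longrightarrow> finite_system (Q i)"
    and l: "minimal_certificate (mb_product k Q) x l"
  shows "\<exists>i\<in>{1..k}. supp (constrs (mb_product k Q)) l \<subseteq> {i} \<times> constrs (Q i)"
proof -
  define S where "S = mb_product k Q"
  have S: "constrs S = (SIGMA i:{1..k}. constrs (Q i))" "conts S = (SIGMA i:{1..k}. conts (Q i))"
    by (simp_all add: S_def mb_product_def)
  have B: "Bcoef S p q = 0" if "fst p \<noteq> fst q" for p q
    using that by (simp add: S_def mb_product_def case_prod_beta)
  have finC: "finite (constrs S)"
    using finite_system_mb_product[of k Q] fin by (simp add: S_def finite_system_def)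
  have l': "l \<in> constrs S \<rightarrow>\<^sub>E {0..}" "0 < (\<Sum>r\<in>constrs S. l r * violation S x r)"
    "\<And>j. j \<in> conts S \<Longrightarrow> (\<Sum>r\<in>constrs S. l r * Bcoef S r j) = 0"
    using l by (auto simp: minimal_certificate_def projected_certificate_iff S_def)
  have "(\<Sum>r\<in>constrs S. l r * violation S x r) =
      (\<Sum>i\<in>{1..k}. \<Sum>r\<in>constrs (Q i). l (i, r) * violation S x (i, r))"
    using fin by (simp add: S sum.Sigma finite_system_def case_prod_beta)
  with l'(2) obtain i where i: "i \<in> {1..k}"
    "0 < (\<Sum>r\<in>constrs (Q i). l (i, r) * violation S x (i, r))"
    by (metis (no_types, lifting) not_less sum_nonpos)
  define l2 where "l2 = (\<lambda>p\<in>constrs S. if fst p = i then l p else 0)"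
  have sum: "(\<Sum>p\<in>constrs S. l2 p * f p) = (\<Sum>r\<in>constrs (Q i). l (i, r) * f (i, r))" for f
  proof -
    have "(\<Sum>p\<in>constrs S. l2 p * f p) = (\<Sum>p\<in>{i} \<times> constrs (Q i). l2 p * f p)"
      using i finC by (intro sum.mono_neutral_right) (auto simp: l2_def S)
    also have "\<dots> = (\<Sum>p\<in>{i} \<times> constrs (Q i). l p * f p)"
      using i by (intro sum.cong) (auto simp: l2_def S)
    also have "\<dots> = (\<Sum>r\<in>constrs (Q i). l (i, r) * f (i, r))"
      by (simp add: sum.cartesian_product' split_def)
    finally show ?thesis .
  qed
  have "(\<Sum>p\<in>constrs S. l2 p * Bcoef S p q) = 0" if "q \<in> conts S" for q
  proof (cases "fst q = i")
    case True
    have "(\<Sum>p\<in>constrs S. l2 p * Bcoef S p q) = (\<Sum>p\<in>constrs S. l p * Bcoef S p q)"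
      using True B by (intro sum.cong) (auto simp: l2_def)
    then show ?thesis using l'(3) that by simp
  next
    case False
    then show ?thesis unfolding sum using B[of "(i, _)" q] by simp
  qed
  then have "projected_certificate S x l2"
    unfolding projected_certificate_iff using l'(1) i(2) unfolding sum by (auto simp: l2_def)
  moreover have "supp (constrs S) l2 \<subseteq> supp (constrs S) l"
    by (auto simp: supp_def l2_def)
  \<comment> \<open>Minimality excludes a strictly smaller support, so the restriction loses no row
    of it.\<close>
  ultimately have "supp (constrs S) l = supp (constrs S) l2"
    using l unfolding minimal_certificate_def S_def by blast
  also have "\<dots> \<subseteq> {i} \<times> constrs (Q i)"
    by (auto simp: supp_def l2_def S split: if_splits)
  finally show ?thesis using i(1) by (auto simp: S_def)
qed

text \<open>With the continuous columns of block \<open>i\<close> as \<open>J\<close>, the support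
  bound leaves at most one row more than the block has continuous variables, and each row
  contributes at most \<open>s i\<close> binary ones.\<close>

lemma minimal_certificate_mb_product:
  assumes fin: "\<And>i. i \<in> {1..k} \<Longrightarrow> finite_system (Q i)"
    and s: "\<And>i r. i \<in> {1..k} \<Longrightarrow> r \<in> constrs (Q i) \<Longrightarrow>
           card (supp (bins (Q i)) (Acoef (Q i) r)) \<le> s i"
    and l: "minimal_certificate (mb_product k Q) x l"
  obtains i where "i \<in> {1..k}"
    "supp (bins (mb_product k Q)) (cert_a (mb_product k Q) l) \<subseteq> {i} \<times> bins (Q i)"
    "card (supp (bins (mb_product k Q)) (cert_a (mb_product k Q) l)) \<le>
       min (s i * (card (conts (Q i)) + 1)) (card (bins (Q i)))"
proof -
  define S where "S = mb_product k Q"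
  define R where "R = supp (constrs S) l"
  define V where "V = supp (bins S) (cert_a S l)"
  have S: "bins S = (SIGMA i:{1..k}. bins (Q i))" "conts S = (SIGMA i:{1..k}. conts (Q i))"
    "constrs S = (SIGMA i:{1..k}. constrs (Q i))"
    by (simp_all add: S_def mb_product_def)
  have finS: "finite_system S"
    using finite_system_mb_product fin by (auto simp: S_def)
  obtain i where i: "i \<in> {1..k}" "R \<subseteq> {i} \<times> constrs (Q i)"
    using minimal_certificate_in_block[OF fin l] by (auto simp: R_def S_def)
  have finR: "finite R" using finS by (auto simp: R_def supp_def finite_system_def)
  have finQ: "finite (bins (Q i))" "finite (conts (Q i))"
    using fin i(1) by (auto simp: finite_system_def)
  have "card R \<le> card ({i} \<times> conts (Q i)) + 1"
    unfolding R_def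
  proof (rule minimal_certificate_card_supp[OF finS])
    show "minimal_certificate S x l" using l by (simp add: S_def)
    show "{i} \<times> conts (Q i) \<subseteq> conts S" using i by (auto simp: S)
    show "Bcoef S r j = 0"
      if "r \<in> supp (constrs S) l" "j \<in> conts S - {i} \<times> conts (Q i)" for r j
    proof -
      have "fst r = i" "fst j \<noteq> i" using that i(2) by (auto simp: S R_def)
      then show ?thesis by (simp add: S_def mb_product_def case_prod_beta)
    qed
  qed
  then have cardR: "card R \<le> card (conts (Q i)) + 1"
    by (simp add: card_cartesian_product_singleton)
  \<comment> \<open>Only an inclusion, since coefficients of different rows may cancel in
    \<open>a\<close>.\<close>
  have V: "V \<subseteq> (\<Union>p\<in>R. {i} \<times> supp (bins (Q i)) (Acoef (Q i) (snd p)))"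
  proof
    fix q assume q: "q \<in> V"
    then have "(\<Sum>p\<in>constrs S. l p * Acoef S p q) \<noteq> 0" and qb: "q \<in> bins S"
      by (auto simp: V_def supp_def cert_a_def)
    then obtain p where p: "p \<in> constrs S" "l p * Acoef S p q \<noteq> 0"
      by (meson sum.not_neutral_contains_not_neutral)
    then have pR: "p \<in> R" by (auto simp: R_def supp_def)
    with i obtain r where r: "p = (i, r)" by auto
    obtain i' j where ij: "q = (i', j)" by force
    have "Acoef S p q = (if i = i' then Acoef (Q i) r j else 0)"
      by (simp add: r ij S_def mb_product_def)
    with p have "i' = i" "Acoef (Q i) r j \<noteq> 0" by (auto split: if_splits)
    with qb pR show "q \<in> (\<Union>p\<in>R. {i} \<times> supp (bins (Q i)) (Acoef (Q i) (snd p)))"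
      using ij r by (force simp: supp_def S)
  qed
  have VB: "V \<subseteq> {i} \<times> bins (Q i)" using V by (auto simp: supp_def)
  have "card V \<le> card (\<Union>p\<in>R. {i} \<times> supp (bins (Q i)) (Acoef (Q i) (snd p)))"
    using V finR finQ by (intro card_mono) (auto simp: supp_def)
  also have "\<dots> \<le> (\<Sum>p\<in>R. card ({i} \<times> supp (bins (Q i)) (Acoef (Q i) (snd p))))"
    using finR by (rule card_UN_le)
  also have "\<dots> \<le> (\<Sum>p\<in>R. s i)"
    using i s by (intro sum_mono) (auto simp: card_cartesian_product_singleton)
  also have "\<dots> \<le> s i * (card (conts (Q i)) + 1)"
    using mult_le_mono2[OF cardR, of "s i"] by (simp add: mult.commute)
  finally have "card V \<le> s i * (card (conts (Q i)) + 1)" .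
  moreover have "card V \<le> card (bins (Q i))"
    using card_mono[OF _ VB] finQ by (simp add: card_cartesian_product_singleton)
  ultimately show ?thesis
    using that[OF i(1)] VB by (simp add: V_def S_def)
qed

text \<open>
  Lower bound for the probability that \<open>D\<close> of the next \<open>j\<close> flips in a block, all of them in a row
  from now on, reduce the distance to a fixed solution from \<open>D\<close> to \<open>0\<close>. Each flip does so with
  probability at least \<open>1 / \<gamma>\<close>, and with certainty if all \<open>n\<close> coordinates are wrong; this saves
  a factor \<open>\<gamma>\<close> if \<open>D = n\<close>, which later pays for rounding the number of iterations down.
\<close>

definition descent_prob :: "nat \<Rightarrow> nat \<Rightarrow> nat \<Rightarrow> nat \<Rightarrow> real" where
  "descent_prob n \<gamma> j D = (if D \<le> j then (1 / real \<gamma>) ^ min D (n - 1) else 0)"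

text \<open>
  Upper bound for the probability that a block at distance \<open>D\<close> is not repaired by its next \<open>r\<close> flips,
  of which the first \<open>r mod n\<close> belong to the current round of \<open>n\<close> flips. A block without
  coordinates or without binary coefficients is never flipped.
\<close>

definition fail_bound :: "nat \<Rightarrow> nat \<Rightarrow> nat \<Rightarrow> nat \<Rightarrow> real" where
  "fail_bound n \<gamma> r D =
     (if n = 0 \<or> \<gamma> = 0 then 0
      else (1 - (1 / real \<gamma>) ^ (n - 1)) ^ (r div n) * (1 - descent_prob n \<gamma> (r mod n) D))"

section \<open>One-step behaviour of the failure bound of a block\<close>

lemma descent_prob_nonneg: "0 \<le> descent_prob n \<gamma> j D"
  by (simp add: descent_prob_def)

lemma inverse_power_le_1: "(1 / real \<gamma>) ^ a \<le> 1"
  by (cases "\<gamma> = 0") (auto simp: power_le_one power_0_left)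

lemma fail_bound_nonneg: "0 \<le> fail_bound n \<gamma> r D"
  using inverse_power_le_1 by (auto simp: fail_bound_def descent_prob_def)

lemma fail_bound_0: "n > 0 \<Longrightarrow> \<gamma> > 0 \<Longrightarrow> D > 0 \<Longrightarrow> fail_bound n \<gamma> 0 D = 1"
  by (simp add: fail_bound_def descent_prob_def)

text \<open>With complete rounds only, the factor for the partial round is at most 1, so the
  starting distance disappears from the bound.\<close>

lemma fail_bound_rounds:
  "n > 0 \<Longrightarrow> \<gamma> > 0 \<Longrightarrow> fail_bound n \<gamma> (n * m) D \<le> (1 - (1 / real \<gamma>) ^ (n - 1)) ^ m"
  using descent_prob_nonneg[of n \<gamma> 0 D] inverse_power_le_1[of \<gamma> "n - 1"]
  by (simp add: fail_bound_def mult_left_le)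

text \<open>Here \<open>\<rho>\<close> is the probability of a good flip. A bad flip is credited
  with nothing; a good one lowers the exponent by one at the price of a factor
  \<open>\<rho> \<ge> 1 / \<gamma>\<close>. At \<open>D = n\<close> the cap \<open>n - 1\<close>
  keeps the exponent unchanged, which \<open>\<rho> = 1\<close> pays for.\<close>

lemma descent_prob_step:
  assumes "\<gamma> > 0" "0 < D" "D \<le> n" "j < n" "1 / real \<gamma> \<le> \<rho>" "\<rho> \<le> 1" "D = n \<Longrightarrow> \<rho> = 1"
  shows "descent_prob n \<gamma> (Suc j) D \<le>
    \<rho> * descent_prob n \<gamma> j (D - 1) + (1 - \<rho>) * descent_prob n \<gamma> j (D + 1)"
proof -
  have "descent_prob n \<gamma> (Suc j) D \<le> \<rho> * descent_prob n \<gamma> j (D - 1)"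
  proof (cases "D \<le> Suc j")
    case True
    obtain D' where D': "D = Suc D'" using assms by (cases D) auto
    show ?thesis
    proof (cases "D = n")
      case True
      then show ?thesis using assms \<open>D \<le> Suc j\<close> D' by (simp add: descent_prob_def)
    next
      case False
      then have "min D (n - 1) = Suc D'" "min D' (n - 1) = D'" using assms D' by auto
      moreover have "(1 / real \<gamma>) * (1 / real \<gamma>) ^ D' \<le> \<rho> * (1 / real \<gamma>) ^ D'"
        using assms by (intro mult_right_mono) auto
      ultimately show ?thesis using True D' by (simp add: descent_prob_def)
    qed
  next
    case False
    then show ?thesis using assms by (simp add: descent_prob_def)
  qed
  moreover have "0 \<le> (1 - \<rho>) * descent_prob n \<gamma> j (D + 1)"
    using assms descent_prob_nonneg by simp
  ultimately show ?thesis by linarith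
qed

text \<open>A supermartingale inequality: on average, a flip does not raise the failure bound for
  the flips that remain.\<close>

lemma fail_bound_step:
  assumes "\<gamma> > 0" "0 < D" "D \<le> n" "1 / real \<gamma> \<le> \<rho>" "\<rho> \<le> 1" "D = n \<Longrightarrow> \<rho> = 1"
  shows "\<rho> * fail_bound n \<gamma> r (D - 1) + (1 - \<rho>) * fail_bound n \<gamma> r (D + 1)
    \<le> fail_bound n \<gamma> (Suc r) D"
proof -
  define q where "q = (1 / real \<gamma>) ^ (n - 1)"
  define F where "F = (1 - q) ^ (r div n)"
  define j where "j = r mod n"
  have n: "n > 0" using assms by simp
  have F: "0 \<le> F" using inverse_power_le_1[of \<gamma> "n - 1"] by (simp add: F_def q_def)
  have j: "j < n" using n by (simp add: j_def)
  have "\<rho> * fail_bound n \<gamma> r (D - 1) + (1 - \<rho>) * fail_bound n \<gamma> r (D + 1) =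
      F * (1 - (\<rho> * descent_prob n \<gamma> j (D - 1) + (1 - \<rho>) * descent_prob n \<gamma> j (D + 1)))"
    using assms n by (simp add: fail_bound_def F_def q_def j_def algebra_simps)
  also have "\<dots> \<le> F * (1 - descent_prob n \<gamma> (Suc j) D)"
    using descent_prob_step[of \<gamma> D n j \<rho>] assms j F by (intro mult_left_mono) auto
  also have "\<dots> \<le> fail_bound n \<gamma> (Suc r) D"
  \<comment> \<open>If \<open>Suc j = n\<close>, this flip opens a round. As
    \<open>D \<le> n\<close>, the whole distance fits into the round, so the bracket is at most
    \<open>1 - q\<close> and becomes one more factor of the power.\<close>
  proof (cases "Suc j = n")
    case True
    then have m: "Suc r mod n = 0" "Suc r div n = Suc (r div n)"
      by (auto simp: mod_Suc div_Suc j_def)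
    have "q \<le> descent_prob n \<gamma> (Suc j) D"
      using True assms by (auto simp: q_def descent_prob_def intro!: power_decreasing)
    then have "F * (1 - descent_prob n \<gamma> (Suc j) D) \<le> F * (1 - q)"
      using F by (intro mult_left_mono) auto
    then show ?thesis
      using assms n m by (simp add: fail_bound_def descent_prob_def F_def q_def mult.commute)
  next
    case False
    then have m: "Suc r mod n = Suc j" "Suc r div n = r div n"
      by (auto simp: mod_Suc div_Suc j_def)
    then show ?thesis
      using assms n by (simp add: fail_bound_def F_def q_def)
  qed
  finally show ?thesis .
qed

section \<open>Number of rounds that suffices for one block\<close>

lemma one_minus_power_le_exp:
  fixes q :: real
  assumes "0 \<le> q" "q \<le> 1" "L \<le> q * real m"
  shows "(1 - q) ^ m \<le> exp (- L)"
proof -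
  have "(1 - q) ^ m \<le> exp (- q) ^ m"
    using assms exp_ge_add_one_self[of "- q"] by (intro power_mono) auto
  also have "\<dots> = exp (- (q * real m))"
    by (simp add: exp_of_nat_mult[symmetric] mult.commute)
  also have "\<dots> \<le> exp (- L)" using assms by simp
  finally show ?thesis .
qed

lemma rounds_ceiling:
  assumes "\<gamma> > 0" "0 \<le> L"
  shows "(1 - (1 / real \<gamma>) ^ (n - 1)) ^ nat \<lceil>L * real \<gamma> ^ n\<rceil> \<le> exp (- L)"
proof (rule one_minus_power_le_exp)
  have g: "real \<gamma> ^ (n - 1) \<le> real \<gamma> ^ n"
    using assms by (intro power_increasing) auto
  have "L \<le> (1 / real \<gamma>) ^ (n - 1) * (L * real \<gamma> ^ n)"
    using assms mult_left_mono[OF g, of L] by (simp add: field_simps)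
  also have "\<dots> \<le> (1 / real \<gamma>) ^ (n - 1) * real (nat \<lceil>L * real \<gamma> ^ n\<rceil>)"
    by (intro mult_left_mono real_nat_ceiling_ge) auto
  finally show "L \<le> (1 / real \<gamma>) ^ (n - 1) * real (nat \<lceil>L * real \<gamma> ^ n\<rceil>)" .
qed (auto simp: inverse_power_le_1)

text \<open>The exponent \<open>n - 1\<close> leaves a spare factor \<open>\<gamma>\<close>. If
  \<open>\<gamma> \<ge> 2\<close>, it absorbs the loss of less than one round from rounding down. If
  \<open>\<gamma> = 1\<close>, a single round never fails, and \<open>1 \<le> L\<close> grants
  one.\<close>

lemma rounds_floor:
  assumes "\<gamma> > 0" "\<gamma> \<le> n" "1 \<le> L"
  shows "(1 - (1 / real \<gamma>) ^ (n - 1)) ^ nat \<lfloor>L * real \<gamma> ^ n\<rfloor> \<le> exp (- L)"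
proof (cases "\<gamma> = 1")
  case True
  then show ?thesis using assms by (simp add: zero_power)
next
  case False
  with assms have n: "n \<ge> 2" and \<gamma>: "real \<gamma> \<ge> 2" by auto
  define p where "p = real \<gamma> ^ (n - 1)"
  have gp: "real \<gamma> ^ n = real \<gamma> * p" using n by (cases n) (auto simp: p_def)
  have "real \<gamma> ^ 1 \<le> p" unfolding p_def using n assms by (intro power_increasing) auto
  with \<gamma> have p2: "2 \<le> p" by simp
  have "2 * (L * p) \<le> real \<gamma> * (L * p)"
    using \<gamma> p2 assms by (intro mult_right_mono) auto
  moreover have "1 * p \<le> L * p" using p2 assms by (intro mult_right_mono) auto
  moreover have "L * real \<gamma> ^ n - 1 \<le> real (nat \<lfloor>L * real \<gamma> ^ n\<rfloor>)" by linarith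
  ultimately have "L * p \<le> real (nat \<lfloor>L * real \<gamma> ^ n\<rfloor>)"
    using p2 assms(3) unfolding gp mult.left_commute[of L "real \<gamma>" p] by linarith
  moreover have "(1 / real \<gamma>) ^ (n - 1) = 1 / p" by (simp add: p_def power_one_over)
  ultimately have "L \<le> (1 / real \<gamma>) ^ (n - 1) * real (nat \<lfloor>L * real \<gamma> ^ n\<rfloor>)"
    using p2 by (simp add: pos_le_divide_eq)
  then show ?thesis
    by (intro one_minus_power_le_exp) (auto simp: inverse_power_le_1)
qed

lemma powr_log2_self: "\<gamma> > 0 \<Longrightarrow> 2 powr (real n * log 2 (real \<gamma>)) = real \<gamma> ^ n"
  by (subst mult.commute, subst powr_powr[symmetric]) (simp add: powr_realpow)

section \<open>Effect of a randomization step on the Hamming distance within a block\<close>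

definition block_dist ::
    "(nat \<Rightarrow> ('r, 'v, 'c) mb_system) \<Rightarrow> (nat \<times> 'v \<Rightarrow> real) \<Rightarrow> (nat \<times> 'v \<Rightarrow> real) \<Rightarrow> nat \<Rightarrow> nat" where
  "block_dist Q z x i = card {j \<in> bins (Q i). x (i, j) \<noteq> z (i, j)}"

lemma block_dist_flip_other: "fst p \<noteq> i \<Longrightarrow> block_dist Q z (flip {p} x) i = block_dist Q z x i"
  by (auto simp: block_dist_def flip_def intro!: arg_cong[of _ _ card])

lemma block_dist_flip_wrong:
  assumes "finite (bins (Q i))" "j \<in> bins (Q i)"
    and "x (i, j) \<in> {0, 1}" "z (i, j) \<in> {0, 1}" "x (i, j) \<noteq> z (i, j)"
  shows "block_dist Q z (flip {(i, j)} x) i = block_dist Q z x i - 1"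
proof -
  have "{j' \<in> bins (Q i). flip {(i, j)} x (i, j') \<noteq> z (i, j')} =
      {j' \<in> bins (Q i). x (i, j') \<noteq> z (i, j')} - {j}"
    using assms by (auto simp: flip_def)
  then show ?thesis using assms by (simp add: block_dist_def)
qed

lemma block_dist_flip_right:
  assumes "finite (bins (Q i))" "j \<in> bins (Q i)" "x (i, j) \<in> {0, 1}" "x (i, j) = z (i, j)"
  shows "block_dist Q z (flip {(i, j)} x) i = block_dist Q z x i + 1"
proof -
  have "{j' \<in> bins (Q i). flip {(i, j)} x (i, j') \<noteq> z (i, j')} =
      insert j {j' \<in> bins (Q i). x (i, j') \<noteq> z (i, j')}"
    using assms by (auto simp: flip_def)
  then show ?thesis using assms by (simp add: block_dist_def)
qed

text \<open>A single sample gives a singleton set of flipped indices, so the step averages over the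
  support of \<open>a\<close>.\<close>

lemma prob_bind_RandWalkSAT_1:
  assumes "finite (supp (bins S) (cert_a S l))" "supp (bins S) (cert_a S l) \<noteq> {}"
  shows "measure_pmf.prob (bind_pmf (RandWalkSAT 1 S l x) f) X =
    (\<Sum>p\<in>supp (bins S) (cert_a S l). measure_pmf.prob (f (flip {p} x)) X) /
      real (card (supp (bins S) (cert_a S l)))"
proof -
  have "bind_pmf (RandWalkSAT 1 S l x) f =
      bind_pmf (pmf_of_set (supp (bins S) (cert_a S l))) (\<lambda>p. f (flip {p} x))"
    unfolding RandWalkSAT_def replicate_pmf_1 by (simp add: bind_map_pmf pmf.map_comp o_def)
  then have "ennreal (measure_pmf.prob (bind_pmf (RandWalkSAT 1 S l x) f) X) =
      (\<Sum>p\<in>supp (bins S) (cert_a S l). ennreal (measure_pmf.prob (f (flip {p} x)) X)) /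
        ennreal (real (card (supp (bins S) (cert_a S l))))"
    using assms
    by (simp add: measure_pmf.emeasure_eq_measure[symmetric] nn_integral_pmf_of_set
        ennreal_of_nat_eq_real_of_nat)
  also have "\<dots> = ennreal ((\<Sum>p\<in>supp (bins S) (cert_a S l).
      measure_pmf.prob (f (flip {p} x)) X) / real (card (supp (bins S) (cert_a S l))))"
    using assms by (simp add: sum_nonneg divide_ennreal card_gt_0_iff)
  finally show ?thesis by (simp add: sum_nonneg)
qed

section \<open>Success probability of a run\<close>

text \<open>\<open>r i\<close> is a budget of flips for block \<open>i\<close>, and each iteration
  spends one unit from the block of its certificate. The sum of the failure bounds is a potential:
  the term of that block obeys \<open>fail_bound_step\<close> and the others stay fixed.\<close>

lemma mbWalkSAT_from_prob:
  fixes Q :: "nat \<Rightarrow> ('r, 'v, 'c) mb_system" and n d s c :: "nat \<Rightarrow> nat" and k :: nat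
  defines "S \<equiv> mb_product k Q"
  assumes fin: "\<And>i. i \<in> {1..k} \<Longrightarrow> finite_system (Q i)"
    and n: "\<And>i. i \<in> {1..k} \<Longrightarrow> card (bins (Q i)) = n i"
    and d: "\<And>i. i \<in> {1..k} \<Longrightarrow> card (conts (Q i)) = d i"
    and s: "\<And>i r. i \<in> {1..k} \<Longrightarrow> r \<in> constrs (Q i) \<Longrightarrow>
           card (supp (bins (Q i)) (Acoef (Q i) r)) \<le> s i"
    and c: "\<And>i. i \<in> {1..k} \<Longrightarrow> c i = min (s i * (d i + 1)) (n i)"
    and z: "z \<in> bins S \<rightarrow>\<^sub>E {0, 1}" "z \<in> proj_bin S"
    and cert: "valid_cert_rule S cert" and lift: "valid_lift_rule S lift"
    and x: "x \<in> bins S \<rightarrow>\<^sub>E {0, 1}" and t: "(\<Sum>i=1..k. r i) \<le> t"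
  shows "1 - (\<Sum>i=1..k. fail_bound (n i) (c i) (r i) (block_dist Q z x i)) \<le>
    measure_pmf.prob (mbWalkSAT_from 1 S cert lift t h x) (Some ` mb_set S)"
proof -
  define F where "F = (\<lambda>r x i. fail_bound (n i) (c i) (r i) (block_dist Q z x i))"
  have S: "bins S = (SIGMA i:{1..k}. bins (Q i))"
    by (simp add: S_def mb_product_def)
  have finB: "finite (bins (Q i))" if "i \<in> {1..k}" for i
    using fin that by (simp add: finite_system_def)
  have dist_le: "block_dist Q z x i \<le> n i" if "i \<in> {1..k}" for x i
    using finB[OF that] by (auto simp: block_dist_def n[OF that, symmetric] intro!: card_mono)
  have solved: "measure_pmf.prob (mbWalkSAT_from 1 S cert lift t h x) (Some ` mb_set S) = 1"
    if "x \<in> bins S \<rightarrow>\<^sub>E {0, 1}" "x \<in> proj_bin S" for t h x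
  proof -
    have "(x, lift x) \<in> lp_relax S"
      using lift that by (simp add: valid_lift_rule_def)
    then have "(x, lift x) \<in> mb_set S"
      using that by (auto simp: mb_set_def mb_points_def lp_relax_def)
    moreover have "mbWalkSAT_from 1 S cert lift t h x = return_pmf (Some (x, lift x))"
      using that by (cases t) auto
    ultimately show ?thesis by simp
  qed
  have visit: "\<exists>i\<in>{1..k}. supp (bins S) (cert_a S (cert h x)) \<subseteq> {i} \<times> bins (Q i) \<and>
      card (supp (bins S) (cert_a S (cert h x))) \<le> c i \<and>
      (\<exists>p\<in>supp (bins S) (cert_a S (cert h x)). x p \<noteq> z p)"
    if "x \<in> bins S \<rightarrow>\<^sub>E {0, 1}" "x \<notin> proj_bin S" for h x
  proof -
    have l: "minimal_certificate S x (cert h x)"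
      using cert that by (simp add: valid_cert_rule_def)
    then have "\<exists>p\<in>supp (bins S) (cert_a S (cert h x)). x p \<noteq> z p"
      using certificate_separates[OF _ z(2)] by (simp add: minimal_certificate_def)
    moreover obtain i where "i \<in> {1..k}"
      "supp (bins S) (cert_a S (cert h x)) \<subseteq> {i} \<times> bins (Q i)"
      "card (supp (bins S) (cert_a S (cert h x))) \<le>
         min (s i * (card (conts (Q i)) + 1)) (card (bins (Q i)))"
      using minimal_certificate_mb_product[OF fin s l[unfolded S_def]] unfolding S_def by blast
    ultimately show ?thesis using n d c by auto
  qed
  have "1 - (\<Sum>i=1..k. F r x i) \<le>
    measure_pmf.prob (mbWalkSAT_from 1 S cert lift t h x) (Some ` mb_set S)"
    using x t
  \<comment> \<open>An iteration changes the point, lowers one budget and extends the history, so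
    all three are generalized.\<close>
  proof (induction t arbitrary: x r h rule: less_induct)
    case (less t x r h)
    show ?case
    proof (cases "x \<in> proj_bin S")
      case True
      then show ?thesis
        using solved[OF less.prems(1) True] by (simp add: F_def sum_nonneg fail_bound_nonneg)
    next
      case False
      define V where "V = supp (bins S) (cert_a S (cert h x))"
      obtain i where i: "i \<in> {1..k}" and V: "V \<subseteq> {i} \<times> bins (Q i)" "card V \<le> c i"
        and ex: "\<exists>p\<in>V. x p \<noteq> z p"
        using visit[OF less.prems(1) False, of h] unfolding V_def by blast
      define D where "D = block_dist Q z x i"
      define C where "C = (\<Sum>i'\<in>{1..k} - {i}. F r x i')"
      have sumF: "(\<Sum>i=1..k. F r x i) = F r x i + C"
        using i by (simp add: C_def sum.remove)
      have C0: "0 \<le> C" by (simp add: C_def F_def sum_nonneg fail_bound_nonneg)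
      have finV: "finite V" using V(1) finB[OF i] finite_subset by blast
      with ex have cardV: "0 < card V" by (auto simp: card_gt_0_iff)
      with V(2) have ci: "0 < c i" by simp
      have Dn: "D \<le> n i" unfolding D_def by (rule dist_le[OF i])
      have D0: "0 < D"
        using ex V(1) finB[OF i] by (auto simp: D_def block_dist_def card_gt_0_iff)
      show ?thesis
      \<comment> \<open>If the budget of the visited block is exhausted, its failure bound is 1
        because \<open>D > 0\<close>, and the claimed lower bound is at most 0.\<close>
      proof (cases "r i = 0")
        case True
        then have "F r x i = 1"
          using D0 Dn ci by (simp add: F_def D_def[symmetric] fail_bound_0)
        then have "1 - (\<Sum>i=1..k. F r x i) \<le> 0" using sumF C0 by simp
        then show ?thesis by (rule order_trans) simp
      next
        case False
        then obtain ri where ri: "r i = Suc ri" by (cases "r i") auto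
        define r' where "r' = r(i := ri)"
        have sumr: "(\<Sum>i=1..k. r i) = Suc (\<Sum>i=1..k. r' i)"
          using i by (simp add: sum.remove[of _ i] r'_def ri)
        then obtain t' where t': "t = Suc t'" "(\<Sum>i=1..k. r' i) \<le> t'"
          using less.prems(2) by (cases t) auto
        \<comment> \<open>\<open>G\<close> holds the good flips, those that correct a coordinate;
          \<open>\<rho>\<close> is the chance to draw one.\<close>
        define G where "G = {p\<in>V. x p \<noteq> z p}"
        define f where "f = fail_bound (n i) (c i) ri"
        define \<rho> where "\<rho> = real (card G) / real (card V)"
        let ?P = "\<lambda>p. measure_pmf.prob (mbWalkSAT_from 1 S cert lift t' (x # h) (flip {p} x))
          (Some ` mb_set S)"
        have P: "1 - C - (if p \<in> G then f (D - 1) else f (D + 1)) \<le> ?P p" if p: "p \<in> V" for p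
        proof -
          obtain j where j: "p = (i, j)" "j \<in> bins (Q i)" using V(1) p by auto
          have pS: "p \<in> bins S" using i j by (simp add: S)
          have bin: "x (i, j) \<in> {0, 1}" "z (i, j) \<in> {0, 1}"
            using less.prems(1) z(1) pS j by (auto simp: PiE_iff)
          have "flip {p} x \<in> bins S \<rightarrow>\<^sub>E {0, 1}"
            using less.prems(1) pS by (fastforce simp: PiE_iff flip_def extensional_def)
          then have "1 - (\<Sum>i=1..k. F r' (flip {p} x) i) \<le> ?P p"
            using less.IH[of t'] t' by simp
          moreover have "(\<Sum>i=1..k. F r' (flip {p} x) i) = F r' (flip {p} x) i + C"
          proof -
            have "(\<Sum>i'\<in>{1..k} - {i}. F r' (flip {p} x) i') = C"
              unfolding C_def using j
              by (intro sum.cong) (auto simp: F_def r'_def block_dist_flip_other)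
            then show ?thesis using i by (simp add: sum.remove)
          qed
          moreover have "F r' (flip {p} x) i = (if p \<in> G then f (D - 1) else f (D + 1))"
            using block_dist_flip_wrong[of Q i j x z] block_dist_flip_right[of Q i j x z]
              finB[OF i] j bin p
            by (auto simp: F_def r'_def f_def D_def G_def)
          ultimately show ?thesis by simp
        qed
        have GV: "G \<subseteq> V" "card G \<le> card V" using finV by (auto simp: G_def intro!: card_mono)
        have "(\<Sum>p\<in>V. if p \<in> G then f (D - 1) else f (D + 1)) =
            card G * f (D - 1) + (card V - card G) * f (D + 1)"
          using finV GV by (simp add: sum.If_cases Int_absorb1 card_Diff_subset finite_subset
              Diff_eq[symmetric])
        moreover have "(\<Sum>p\<in>V. 1 - C - (if p \<in> G then f (D - 1) else f (D + 1))) =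
            card V * (1 - C) - (\<Sum>p\<in>V. if p \<in> G then f (D - 1) else f (D + 1))"
          by (simp only: sum_subtractf[of "\<lambda>_. 1 - C"] sum_constant)
        ultimately have avg: "(\<Sum>p\<in>V. 1 - C - (if p \<in> G then f (D - 1) else f (D + 1))) / card V =
            1 - C - (\<rho> * f (D - 1) + (1 - \<rho>) * f (D + 1))"
          using cardV GV by (simp add: \<rho>_def of_nat_diff field_simps)
        have "\<rho> * f (D - 1) + (1 - \<rho>) * f (D + 1) \<le> fail_bound (n i) (c i) (Suc ri) D"
          unfolding f_def
        proof (rule fail_bound_step[OF ci D0 Dn])
          have "card G > 0" using ex finV by (auto simp: G_def card_gt_0_iff)
          then show "1 / real (c i) \<le> \<rho>"
            unfolding \<rho>_def using V(2) cardV by (intro frac_le) auto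
          show "\<rho> \<le> 1" using GV cardV by (simp add: \<rho>_def)
          assume "D = n i"
          then have "{j \<in> bins (Q i). x (i, j) \<noteq> z (i, j)} = bins (Q i)"
            using finB[OF i] n[OF i] by (intro card_subset_eq) (auto simp: D_def block_dist_def)
          then have "G = V" using V(1) by (auto simp: G_def)
          then show "\<rho> = 1" using cardV by (simp add: \<rho>_def)
        qed
        then have "1 - (\<Sum>i=1..k. F r x i) \<le> 1 - C - (\<rho> * f (D - 1) + (1 - \<rho>) * f (D + 1))"
          unfolding sumF by (simp add: F_def ri D_def)
        also have "\<dots> \<le> (\<Sum>p\<in>V. ?P p) / card V"
          unfolding avg[symmetric] using P by (intro divide_right_mono sum_mono) auto
        also have "\<dots> = measure_pmf.prob (mbWalkSAT_from 1 S cert lift t h x) (Some ` mb_set S)"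
          using \<open>x \<notin> proj_bin S\<close> finV ex
          by (subst prob_bind_RandWalkSAT_1[symmetric, where S = S and l = "cert h x" and x = x, folded V_def])
            (auto simp: t')
        finally show ?thesis .
      qed
    qed
  qed
  then show ?thesis by (simp add: F_def)
qed

text \<open>Each block gets \<open>m i\<close> complete rounds and a share
  \<open>\<delta> / k\<close> of the failure probability. Leaving \<open>m\<close> open serves both
  ways of rounding.\<close>

lemma mbWalkSAT_prob:
  fixes Q :: "nat \<Rightarrow> ('r, 'v, 'c) mb_system" and n d s c m :: "nat \<Rightarrow> nat"
  assumes k: "k \<ge> 1"
    and fin: "\<And>i. i \<in> {1..k} \<Longrightarrow> finite_system (Q i)"
    and n: "\<And>i. i \<in> {1..k} \<Longrightarrow> card (bins (Q i)) = n i"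
    and d: "\<And>i. i \<in> {1..k} \<Longrightarrow> card (conts (Q i)) = d i"
    and feasible: "mb_set (mb_product k Q) \<noteq> {}"
    and s: "\<And>i r. i \<in> {1..k} \<Longrightarrow> r \<in> constrs (Q i) \<Longrightarrow>
           card (supp (bins (Q i)) (Acoef (Q i) r)) \<le> s i"
    and c: "\<And>i. i \<in> {1..k} \<Longrightarrow> c i = min (s i * (d i + 1)) (n i)"
    and \<delta>: "0 < \<delta>"
    and start: "start \<in> mb_points (mb_product k Q)"
    and cert: "valid_cert_rule (mb_product k Q) cert"
    and lift: "valid_lift_rule (mb_product k Q) lift"
    and m: "\<And>i. i \<in> {1..k} \<Longrightarrow> n i > 0 \<Longrightarrow> c i > 0 \<Longrightarrow>
      (1 - (1 / real (c i)) ^ (n i - 1)) ^ m i \<le> \<delta> / real k"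
    and t: "(\<Sum>i=1..k. n i * m i) \<le> t"
  shows "measure_pmf.prob (mbWalkSAT 1 (mb_product k Q) cert lift start t)
    (Some ` mb_set (mb_product k Q)) \<ge> 1 - \<delta>"
proof -
  obtain z y where "(z, y) \<in> mb_set (mb_product k Q)" using feasible by auto
  then have z: "z \<in> bins (mb_product k Q) \<rightarrow>\<^sub>E {0, 1}" "z \<in> proj_bin (mb_product k Q)"
    by (force simp: mb_set_def mb_points_def proj_bin_def)+
  have x: "fst start \<in> bins (mb_product k Q) \<rightarrow>\<^sub>E {0, 1}"
    using start by (auto simp: mb_points_def)
  have "(\<Sum>i=1..k. fail_bound (n i) (c i) (n i * m i) (block_dist Q z (fst start) i)) \<le>
      (\<Sum>i=1..k. \<delta> / real k)"
  proof (rule sum_mono)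
    fix i assume i: "i \<in> {1..k}"
    show "fail_bound (n i) (c i) (n i * m i) (block_dist Q z (fst start) i) \<le> \<delta> / real k"
    proof (cases "n i > 0 \<and> c i > 0")
      case True
      then show ?thesis
        using fail_bound_rounds[of "n i" "c i" "m i"] m[OF i] order_trans by blast
    next
      case False
      then show ?thesis using \<delta> by (auto simp: fail_bound_def)
    qed
  qed
  also have "\<dots> = \<delta>" using k by simp
  finally show ?thesis
    using mbWalkSAT_from_prob[OF fin n d s c z cert lift x t, of "[]"]
    unfolding mbWalkSAT_def by linarith
qed

text \<open>Rounding the whole bound down requires \<open>1 \<le> ln (k / \<delta>)\<close>:
  otherwise a single block with \<open>n = c = 1\<close> would get 0 iterations and could not leave
  an infeasible start. The second conjunct covers all \<open>\<delta>\<close> by rounding up the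
  number of rounds in each block.\<close>

theorem theorem2p1:
  fixes k :: nat and Q :: "nat \<Rightarrow> ('r, 'v, 'c) mb_system"
    and n d s c :: "nat \<Rightarrow> nat" and nbar :: nat and \<delta> :: real
    and start :: "(nat \<times> 'v \<Rightarrow> real) \<times> (nat \<times> 'c \<Rightarrow> real)"
    and cert :: "(nat \<times> 'v \<Rightarrow> real) list \<Rightarrow> (nat \<times> 'v \<Rightarrow> real) \<Rightarrow> (nat \<times> 'r \<Rightarrow> real)"
    and lift :: "(nat \<times> 'v \<Rightarrow> real) \<Rightarrow> (nat \<times> 'c \<Rightarrow> real)"
  assumes "k \<ge> 1"
    and "\<And>i. i \<in> {1..k} \<Longrightarrow> finite_system (Q i)"
    and "\<And>i. i \<in> {1..k} \<Longrightarrow> card (bins (Q i)) = n i"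
    and "\<And>i. i \<in> {1..k} \<Longrightarrow> card (conts (Q i)) = d i"
    and "mb_set (mb_product k Q) \<noteq> {}"
    and "\<And>i r. i \<in> {1..k} \<Longrightarrow> r \<in> constrs (Q i) \<Longrightarrow>
           card (supp (bins (Q i)) (Acoef (Q i) r)) \<le> s i"
    and "\<And>i. i \<in> {1..k} \<Longrightarrow> c i = min (s i * (d i + 1)) (n i)"
    and "nbar = Max (n ` {1..k})"
    and "0 < \<delta>" and "\<delta> < 1"
    and "start \<in> mb_points (mb_product k Q)"
    and "valid_cert_rule (mb_product k Q) cert"
    and "valid_lift_rule (mb_product k Q) lift"
  shows "(1 \<le> ln (real k / \<delta>) \<longrightarrow>
           measure_pmf.prob
             (mbWalkSAT 1 (mb_product k Q) cert lift start
               (nat \<lfloor>ln (real k / \<delta>) *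
                     (\<Sum>i=1..k. real (n i) * 2 powr (real (n i) * log 2 (real (c i))))\<rfloor>))
             (Some ` mb_set (mb_product k Q)) \<ge> 1 - \<delta>) \<and>
         measure_pmf.prob
           (mbWalkSAT 1 (mb_product k Q) cert lift start
             (\<Sum>i=1..k. n i * nat \<lceil>ln (real k / \<delta>) * 2 powr (real (n i) * log 2 (real (c i)))\<rceil>))
           (Some ` mb_set (mb_product k Q)) \<ge> 1 - \<delta> \<and>
         ln (real k / \<delta>) *
           (\<Sum>i=1..k. real (n i) * 2 powr (real (n i) * log 2 (real (c i))))
         \<le> real nbar * real k * 2 powr (real nbar * log 2 (real nbar)) * ln (real k / \<delta>)"
proof -
  define L where "L = ln (real k / \<delta>)"
  define N where "N = (\<lambda>i. 2 powr (real (n i) * log 2 (real (c i))))"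
  have "1 < real k / \<delta>"
    using assms(1,9,10) by (simp add: less_divide_eq)
  then have L0: "0 < L" and expL: "exp (- L) = \<delta> / real k"
    using assms(1,9) by (simp_all add: L_def exp_minus)
  have N: "N i = real (c i) ^ n i" if "c i > 0" for i
    using that by (simp add: N_def powr_log2_self)
  have cn: "c i \<le> n i" if "i \<in> {1..k}" for i
    using assms(7)[OF that] by simp
  note prob = mbWalkSAT_prob[where n = n and d = d and s = s and c = c, OF assms(1-7,9,11-13)]
  have 1: "measure_pmf.prob
      (mbWalkSAT 1 (mb_product k Q) cert lift start (nat \<lfloor>L * (\<Sum>i=1..k. real (n i) * N i)\<rfloor>))
      (Some ` mb_set (mb_product k Q)) \<ge> 1 - \<delta>" if "1 \<le> L"
  proof (rule prob[where m = "\<lambda>i. nat \<lfloor>L * N i\<rfloor>"])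
    fix i assume "i \<in> {1..k}" "c i > 0"
    then show "(1 - (1 / real (c i)) ^ (n i - 1)) ^ nat \<lfloor>L * N i\<rfloor> \<le> \<delta> / real k"
      using rounds_floor[of "c i" "n i" L] cn that N expL by simp
  next
    \<comment> \<open>Rounding down within each block gives an integer total below the real bound,
      hence below its floor.\<close>
    have "real (\<Sum>i=1..k. n i * nat \<lfloor>L * N i\<rfloor>) \<le> (\<Sum>i=1..k. real (n i) * (L * N i))"
      unfolding of_nat_sum of_nat_mult using L0
      by (intro sum_mono mult_left_mono) (auto simp: N_def)
    also have "\<dots> = L * (\<Sum>i=1..k. real (n i) * N i)"
      by (simp add: sum_distrib_left mult.left_commute)
    finally show "(\<Sum>i=1..k. n i * nat \<lfloor>L * N i\<rfloor>) \<le> nat \<lfloor>L * (\<Sum>i=1..k. real (n i) * N i)\<rfloor>"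
      by (rule le_nat_floor)
  qed
  have 2: "measure_pmf.prob
      (mbWalkSAT 1 (mb_product k Q) cert lift start (\<Sum>i=1..k. n i * nat \<lceil>L * N i\<rceil>))
      (Some ` mb_set (mb_product k Q)) \<ge> 1 - \<delta>"
  proof (rule prob[where m = "\<lambda>i. nat \<lceil>L * N i\<rceil>"])
    fix i assume "i \<in> {1..k}" "c i > 0"
    then show "(1 - (1 / real (c i)) ^ (n i - 1)) ^ nat \<lceil>L * N i\<rceil> \<le> \<delta> / real k"
      using rounds_ceiling[of "c i" L "n i"] N expL L0 by simp
  qed simp_all
  have nN: "real (n i) * N i \<le> real nbar * 2 powr (real nbar * log 2 (real nbar))"
    if i: "i \<in> {1..k}" for i
  proof (cases "n i = 0")
    case False
    have nb: "n i \<le> nbar" using i by (simp add: assms(8))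
    \<comment> \<open>Since \<open>n i > 0\<close> forces \<open>nbar \<ge> 1\<close>, the right
      side is nonnegative; this settles \<open>c i = 0\<close>, where
      \<open>log 2 0 = 0\<close>.\<close>
    have "log 2 (real (c i)) \<le> log 2 (real nbar)"
      using cn[OF i] nb False by (cases "c i = 0") (simp_all add: log_def divide_right_mono)
    moreover have "0 \<le> log 2 (real nbar)" using nb False by simp
    ultimately have "real (n i) * log 2 (real (c i)) \<le> real nbar * log 2 (real nbar)"
      using nb by (meson mult_left_mono mult_right_mono of_nat_0_le_iff of_nat_mono order_trans)
    then show ?thesis using nb by (auto simp: N_def intro!: mult_mono)
  qed simp
  have "(\<Sum>i=1..k. real (n i) * N i) \<le>
      (\<Sum>i=1..k. real nbar * 2 powr (real nbar * log 2 (real nbar)))"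
    by (intro sum_mono nN) auto
  then have 3: "L * (\<Sum>i=1..k. real (n i) * N i) \<le>
      real nbar * real k * 2 powr (real nbar * log 2 (real nbar)) * L"
    using mult_left_mono[of _ _ L] L0 by (fastforce simp: mult_ac)
  show ?thesis
    using 1 2 3 unfolding L_def N_def by blast
qed

end
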